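(* Let $\alpha_1,\dots,\alpha_p>0$, $\beta_1,\dots,\beta_q>0$, $B_1,\dots,B_q\ge0$ and $n\in\mathbb{N}$. For $m\in\mathbb{N}$ and $z>0$ put $$\Psi^{m}(z)=\sum_{k=m+1}^\infty\frac{\prod_{j=1}^p\Gamma(\alpha_j)\,z^k}{k!\prod_{j=1}^q\Gamma(\beta_j+kB_j)},\qquad \mathcal{K}_n(z)=\frac{\Psi^{n}(z)\,\Psi^{n+2}(z)}{\big(\Psi^{n+1}(z)\big)^2}.$$ Then the function $z\mapsto\mathcal{K}_n(z)$ is increasing on $(0,\infty)$. Moreover, for all $z\in(0,\infty)$ $$\left(\frac{n+2}{n+3}\right)\left(\frac{\prod_{j=1}^q\Gamma^2(\beta_j+(n+2)B_j)}{\prod_{j=1}^q\Gamma(\beta_j+(n+1)B_j)\,\Gamma(\beta_j+(n+3)B_j)}\right)\big(\Psi^{n+1}(z)\big)^2\le\Psi^{n}(z)\,\Psi^{n+2}(z),$$ and the constant multiplying $\big(\Psi^{n+1}(z)\big)^2$ on the left-hand side is sharp (it cannot be replaced by a larger constant so that the inequality holds for all $z>0$).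
   Context: $\Psi^{m}(z)$ is the section ${}_p\Psi_q^{m}\Big[\begin{matrix}(\alpha_1,0),\dots,(\alpha_p,0)\\ (\beta_1,B_1),\dots,(\beta_q,B_q)\end{matrix}\Big|z\Big]$ of the Fox-Wright series ${}_p\Psi_q\Big[\begin{matrix}(\alpha_1,A_1),\dots,(\alpha_p,A_p)\\ (\beta_1,B_1),\dots,(\beta_q,B_q)\end{matrix}\Big|z\Big]=\sum_{k=0}^\infty\frac{\prod_{j=1}^p\Gamma(\alpha_j+kA_j)}{\prod_{j=1}^q\Gamma(\beta_j+kB_j)}\frac{z^k}{k!}$ (with $A=0$), obtained by removing the terms $k=0,\dots,m$. "Increasing" is meant in the weak (nondecreasing) sense. $\mathbb{N}=\{1,2,3,\dots\}$. *)

theory Defs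
  imports "HOL-Analysis.Analysis"
begin

text \<open>
  The parameter families \<open>\<alpha>, A\<close> are indexed by \<open>{1..p}\<close> and \<open>\<beta>, B\<close> by \<open>{1..q}\<close>;
  values at other indices are irrelevant.
\<close>

definition fox_wright_term ::
  "nat \<Rightarrow> nat \<Rightarrow> (nat \<Rightarrow> real) \<Rightarrow> (nat \<Rightarrow> real) \<Rightarrow> (nat \<Rightarrow> real) \<Rightarrow> (nat \<Rightarrow> real) \<Rightarrow> real \<Rightarrow> nat \<Rightarrow> real"
where
  "fox_wright_term p q \<alpha> A \<beta> B z k =
     (\<Prod>j=1..p. Gamma (\<alpha> j + real k * A j)) / (\<Prod>j=1..q. Gamma (\<beta> j + real k * B j))
       * (z ^ k / fact k)"

text \<open>The Fox-Wright series with the terms of index \<open>0, \<dots>, m\<close> removed.\<close>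

definition fox_wright_section ::
  "nat \<Rightarrow> nat \<Rightarrow> (nat \<Rightarrow> real) \<Rightarrow> (nat \<Rightarrow> real) \<Rightarrow> (nat \<Rightarrow> real) \<Rightarrow> (nat \<Rightarrow> real) \<Rightarrow> nat \<Rightarrow> real \<Rightarrow> real"
where
  "fox_wright_section p q \<alpha> A \<beta> B m z = (\<Sum>k. fox_wright_term p q \<alpha> A \<beta> B z (k + (m + 1)))"

definition Psi_sec ::
  "nat \<Rightarrow> nat \<Rightarrow> (nat \<Rightarrow> real) \<Rightarrow> (nat \<Rightarrow> real) \<Rightarrow> (nat \<Rightarrow> real) \<Rightarrow> nat \<Rightarrow> real \<Rightarrow> real"
where
  "Psi_sec p q \<alpha> \<beta> B = fox_wright_section p q \<alpha> (\<lambda>_. 0) \<beta> B"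

lemma Psi_sec_eq:
  "Psi_sec p q \<alpha> \<beta> B m z =
     (\<Sum>k. (\<Prod>j=1..p. Gamma (\<alpha> j)) * z ^ (k + (m + 1)) /
            (fact (k + (m + 1)) * (\<Prod>j=1..q. Gamma (\<beta> j + real (k + (m + 1)) * B j))))"
  by (simp add: Psi_sec_def fox_wright_section_def fox_wright_term_def mult_ac)

definition K_ratio ::
  "nat \<Rightarrow> nat \<Rightarrow> (nat \<Rightarrow> real) \<Rightarrow> (nat \<Rightarrow> real) \<Rightarrow> (nat \<Rightarrow> real) \<Rightarrow> nat \<Rightarrow> real \<Rightarrow> real"
where
  "K_ratio p q \<alpha> \<beta> B n z =
     Psi_sec p q \<alpha> \<beta> B n z * Psi_sec p q \<alpha> \<beta> B (n + 2) z / (Psi_sec p q \<alpha> \<beta> B (n + 1) z)\<^sup>2"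

end

theory Submission
  imports Defs
begin

text \<open>
  Up to the constant \<open>\<Prod>\<Gamma>(\<alpha>\<^sub>j)\<close> and powers of \<open>z\<close>, the sections \<open>\<Psi>\<^sup>n\<close>, \<open>\<Psi>\<^sup>n\<^sup>+\<^sup>1\<close>, \<open>\<Psi>\<^sup>n\<^sup>+\<^sup>2\<close> are the
  series \<open>F\<^sub>0, F\<^sub>1, F\<^sub>2\<close> with \<open>F\<^sub>i(z) = \<Sum>w\<^sub>k\<^sub>+\<^sub>i z\<^sup>k\<close>, where \<open>w\<^sub>k = 1 / (N! \<Prod>\<Gamma>(\<beta>\<^sub>j + N B\<^sub>j))\<close> and
  \<open>N = k + n + 1\<close>.  All powers of \<open>z\<close> cancel in \<open>\<K>\<^sub>n\<close>, so that \<open>\<K>\<^sub>n = F\<^sub>0 F\<^sub>2 / F\<^sub>1\<^sup>2\<close> is a quotient of two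
  power series with positive coefficients, say \<open>a\<^sub>j\<close> and \<open>b\<^sub>j\<close>.  Such a quotient increases on
  \<open>(0, \<infinity>)\<close> as soon as \<open>a\<^sub>j / b\<^sub>j\<close> increases in \<open>j\<close> (Biernacki and Krzyz, \<open>powser_cross_mono\<close>).

  The difference of the coefficients telescopes:
  \<open>b\<^sub>j - a\<^sub>j = w\<^sub>1 w\<^sub>j\<^sub>+\<^sub>1 - w\<^sub>0 w\<^sub>j\<^sub>+\<^sub>2 = w\<^sub>0 w\<^sub>j\<^sub>+\<^sub>1 (r\<^sub>0 - r\<^sub>j\<^sub>+\<^sub>1)\<close> with \<open>r\<^sub>k = w\<^sub>k\<^sub>+\<^sub>1 / w\<^sub>k\<close>.  Hence
  \<open>1 - a\<^sub>j / b\<^sub>j = w\<^sub>0 s\<^sub>j / D\<^sub>j\<close>, where \<open>s\<^sub>j = (r\<^sub>0 - r\<^sub>j\<^sub>+\<^sub>1) / (j + 1)\<close> and \<open>D\<^sub>j = b\<^sub>j / ((j + 1) w\<^sub>j\<^sub>+\<^sub>1)\<close>.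
  If \<open>r\<close> is convex, then the chord slope \<open>s\<^sub>j\<close> decreases (\<open>convex_seq_chord_antimono\<close>); if \<open>r\<close>
  decreases, that is, if \<open>w\<close> is log-concave, then \<open>D\<^sub>j\<close> increases
  (\<open>log_concave_convolution_mono\<close>).  Log-concavity alone would not suffice: it allows
  \<open>r\<close> constant at first and decreasing later, and then \<open>a\<^sub>j / b\<^sub>j\<close> falls.

  Both properties of \<open>r\<close> come from Euler's limit formula, which writes \<open>\<Gamma>(x) / \<Gamma>(x + t)\<close> as a limit
  of products of factors \<open>1 + t / (x + i)\<close>.  Each factor is decreasing in \<open>x\<close>, and log-convex along
  the progression \<open>x, x + t, x + 2t\<close>; both survive products and limits.  The factor \<open>1 / (N + 1)\<close>
  of \<open>r\<^sub>k\<close> that stems from the factorial has the same two properties, and log-convex sequences are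
  convex.

  Finally \<open>\<K>\<^sub>n(z)\<close> tends to \<open>a\<^sub>0 / b\<^sub>0 = w\<^sub>0 w\<^sub>2 / w\<^sub>1\<^sup>2\<close> as \<open>z \<rightarrow> 0\<close>, and this is the constant of the
  inequality.  By monotonicity the limit is also the infimum of \<open>\<K>\<^sub>n\<close>, which gives the inequality and
  its sharpness together.
\<close>

section \<open>Quotients of power series\<close>

lemma divide_le_divide_cross:
  fixes a b c d :: real
  assumes "0 < b" "0 < d" "a * d \<le> c * b"
  shows "a / b \<le> c / d"
  using assms by (simp add: field_simps)

text \<open>
  The theorem of Biernacki and Krzyz in cross-multiplied form.  The difference of the two sides,
  for partial sums, is half of the double sum of
  \<open>(a\<^sub>j b\<^sub>i - a\<^sub>i b\<^sub>j) (y\<^sup>j x\<^sup>i - x\<^sup>j y\<^sup>i)\<close>, in which both factors have the sign of \<open>j - i\<close>.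
\<close>
lemma powser_cross_mono:
  fixes a b :: "nat \<Rightarrow> real"
  assumes pos: "\<And>k. b k > 0" and mono: "mono (\<lambda>k. a k / b k)" and xy: "0 \<le> x" "x \<le> y"
    and summ: "\<And>z. summable (\<lambda>k. a k * z ^ k)" "\<And>z. summable (\<lambda>k. b k * z ^ k)"
  shows "(\<Sum>k. a k * x ^ k) * (\<Sum>k. b k * y ^ k) \<le> (\<Sum>k. a k * y ^ k) * (\<Sum>k. b k * x ^ k)"
proof -
  define A B where "A = (\<lambda>z N. \<Sum>k<N. a k * z ^ k)" and "B = (\<lambda>z N. \<Sum>k<N. b k * z ^ k)"
  have lim: "(\<lambda>N. A z N) \<longlonglongrightarrow> (\<Sum>k. a k * z ^ k)" "(\<lambda>N. B z N) \<longlonglongrightarrow> (\<Sum>k. b k * z ^ k)" for z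
    unfolding A_def B_def using summ by (simp_all add: summable_LIMSEQ)
  have le: "i \<le> j \<Longrightarrow> 0 \<le> (a j * b i - a i * b j) * (y ^ j * x ^ i - x ^ j * y ^ i)" for i j
  proof (rule mult_nonneg_nonneg)
    assume ij: "i \<le> j"
    show "0 \<le> a j * b i - a i * b j"
      using monoD[OF mono ij] pos[of i] pos[of j] by (simp add: field_simps)
    have "x ^ (j - i) * (x ^ i * y ^ i) \<le> y ^ (j - i) * (x ^ i * y ^ i)"
      using xy by (intro mult_right_mono power_mono) auto
    moreover have "z ^ j = z ^ (j - i) * z ^ i" for z :: real
      using ij by (simp flip: power_add)
    ultimately show "0 \<le> y ^ j * x ^ i - x ^ j * y ^ i" by (simp add: mult_ac)
  qed
  have nonneg: "0 \<le> (a j * b i - a i * b j) * (y ^ j * x ^ i - x ^ j * y ^ i)" for i j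
    using le[of i j] le[of j i] by (cases "i \<le> j") (auto simp: algebra_simps)
  have "A x N * B y N \<le> A y N * B x N" for N
  proof -
    have "0 \<le> (\<Sum>i<N. \<Sum>j<N. (a j * b i - a i * b j) * (y ^ j * x ^ i - x ^ j * y ^ i))"
      by (intro sum_nonneg nonneg)
    also have "\<dots> = (\<Sum>i<N. \<Sum>j<N. (a j * y ^ j) * (b i * x ^ i) + (a i * y ^ i) * (b j * x ^ j)
                    - (a j * x ^ j) * (b i * y ^ i) - (a i * x ^ i) * (b j * y ^ j))"
      by (intro sum.cong refl) (simp add: algebra_simps)
    also have "\<dots> = 2 * (A y N * B x N) - 2 * (A x N * B y N)"
      unfolding A_def B_def
      by (simp add: sum.distrib sum_subtractf mult.commute flip: sum_distrib_left sum_distrib_right)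
    finally show ?thesis by simp
  qed
  then show ?thesis
    by (intro LIMSEQ_le[OF tendsto_mult[OF lim(1) lim(2)] tendsto_mult[OF lim(1) lim(2)]]) auto
qed

section \<open>Coefficients of the Turan quotient\<close>

text \<open>
  For \<open>T(i, j) = v\<^sub>i v\<^sub>j\<^sub>-\<^sub>i / v\<^sub>j\<close> the claim is that the mean of \<open>T(i, j)\<close> over \<open>i \<le> j\<close> increases in \<open>j\<close>.
  Log-concavity makes row \<open>j + 1\<close> dominate row \<open>j\<close> in both alignments:
  \<open>T(i, j)\<close> is at most \<open>T(i, j + 1)\<close> and at most \<open>T(i + 1, j + 1)\<close>.  Adding these with
  weights \<open>j + 1 - i\<close> and \<open>i + 1\<close> counts each term of row \<open>j\<close> exactly \<open>j + 2\<close> times and each term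
  of row \<open>j + 1\<close> exactly \<open>j + 1\<close> times.
\<close>
lemma log_concave_convolution_mono:
  fixes v :: "nat \<Rightarrow> real"
  assumes pos: "\<And>k. v k > 0" and dec: "antimono (\<lambda>k. v (Suc k) / v k)"
  shows "mono (\<lambda>j. (\<Sum>i\<le>j. v i * v (j - i)) / (real (Suc j) * v j))"
proof (rule mono_iff_le_Suc[THEN iffD2], rule allI)
  fix j
  let ?d = "\<lambda>j. \<Sum>i\<le>j. v i * v (j - i)"
  have ratio: "v (Suc j) * v i \<le> v (Suc i) * v j" if "i \<le> j" for i
    using antimonoD[OF dec that] pos[of i] pos[of j] by (simp add: field_simps)
  have up: "v i * v (j - i) * v (Suc j) \<le> v i * v (Suc j - i) * v j"
           "v i * v (j - i) * v (Suc j) \<le> v (Suc i) * v (j - i) * v j" if "i \<le> j" for i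
    using mult_left_mono[OF ratio[of "j - i"], of "v i"] mult_left_mono[OF ratio[OF that], of "v (j - i)"]
      that less_imp_le[OF pos] by (simp_all add: Suc_diff_le mult_ac)
  have "real (j + 2) * ?d j * v (Suc j)
      = (\<Sum>i\<le>j. real (Suc j - i) * (v i * v (j - i) * v (Suc j)) + real (Suc i) * (v i * v (j - i) * v (Suc j)))"
    unfolding sum_distrib_left sum_distrib_right
    by (intro sum.cong refl) (simp add: of_nat_diff algebra_simps)
  also have "\<dots> \<le> (\<Sum>i\<le>j. real (Suc j - i) * (v i * v (Suc j - i) * v j) + real (Suc i) * (v (Suc i) * v (j - i) * v j))"
    by (intro sum_mono add_mono mult_left_mono up) auto
  also have "\<dots> = (\<Sum>i\<le>Suc j. real (Suc j - i) * (v i * v (Suc j - i) * v j)) + (\<Sum>i\<le>Suc j. real i * (v i * v (Suc j - i) * v j))"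
    unfolding sum.distrib
    using sum.atMost_Suc[of "\<lambda>i. real (Suc j - i) * (v i * v (Suc j - i) * v j)" j]
      sum.atMost_Suc_shift[of "\<lambda>i. real i * (v i * v (Suc j - i) * v j)" j] by simp
  also have "\<dots> = real (Suc j) * ?d (Suc j) * v j"
    unfolding sum_distrib_left sum_distrib_right sum.distrib[symmetric]
    by (intro sum.cong refl) (simp add: of_nat_diff algebra_simps)
  finally show "?d j / (real (Suc j) * v j) \<le> ?d (Suc j) / (real (Suc (Suc j)) * v (Suc j))"
    using pos by (intro divide_le_divide_cross) (simp_all add: mult_ac)
qed

text \<open>
  \<open>r\<^sub>0 - r\<^sub>j\<^sub>+\<^sub>1\<close> is a sum of \<open>j + 1\<close> decrements, each at least as large as the next decrement
  \<open>r\<^sub>j\<^sub>+\<^sub>1 - r\<^sub>j\<^sub>+\<^sub>2\<close>; so including that one does not raise the mean.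
\<close>
lemma convex_seq_chord_antimono:
  fixes r :: "nat \<Rightarrow> real"
  assumes convex: "\<And>k. 2 * r (Suc k) \<le> r k + r (Suc (Suc k))"
  shows "antimono (\<lambda>j. (r 0 - r (Suc j)) / real (Suc j))"
proof -
  have "real (Suc j) * (r (Suc j) - r (Suc (Suc j))) \<le> r 0 - r (Suc j)" for j
  proof (induction j)
    case 0
    show ?case using convex[of 0] by simp
  next
    case (Suc j)
    have "real (Suc (Suc j)) * (r (Suc (Suc j)) - r (Suc (Suc (Suc j))))
        \<le> real (Suc (Suc j)) * (r (Suc j) - r (Suc (Suc j)))"
      using convex[of "Suc j"] by (intro mult_left_mono) auto
    then show ?case using Suc.IH by (simp add: algebra_simps)
  qed
  then show ?thesis
    by (auto simp: antimono_iff_le_Suc field_simps)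
qed

lemma log_convex_imp_convex_step:
  fixes x y z :: real
  assumes "0 \<le> x" "0 \<le> z" "y\<^sup>2 \<le> x * z"
  shows "2 * y \<le> x + z"
proof (rule power2_le_imp_le)
  have "(2 * y)\<^sup>2 \<le> 4 * (x * z)"
    using assms(3) by (simp add: power_mult_distrib)
  also have "\<dots> \<le> (x - z)\<^sup>2 + 4 * (x * z)" by simp
  also have "\<dots> = (x + z)\<^sup>2" by (simp add: power2_eq_square algebra_simps)
  finally show "(2 * y)\<^sup>2 \<le> (x + z)\<^sup>2" .
qed (use assms in auto)

text \<open>
  The coefficients of \<open>F\<^sub>0 F\<^sub>2\<close> and \<open>F\<^sub>1\<^sup>2\<close>, compared through \<open>1 - a\<^sub>j / b\<^sub>j = w\<^sub>0 s\<^sub>j / D\<^sub>j\<close>: a decreasing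
  nonnegative numerator over an increasing positive denominator.
\<close>
lemma convolution_quotient_mono:
  fixes w :: "nat \<Rightarrow> real"
  assumes pos: "\<And>k. w k > 0" 
    and dec: "antimono (\<lambda>k. w (Suc k) / w k)"
    and convex: "\<And>k. 2 * (w (k + 2) / w (k + 1)) \<le> w (k + 1) / w k + w (k + 3) / w (k + 2)"
  shows "mono (\<lambda>j. (\<Sum>i\<le>j. w i * w (j - i + 2)) / (\<Sum>i\<le>j. w (i + 1) * w (j - i + 1)))"
proof (rule mono_iff_le_Suc[THEN iffD2], rule allI)
  fix j
  define d s D where "d = (\<lambda>j. \<Sum>i\<le>j. w (i + 1) * w (j - i + 1))"
    and "s = (\<lambda>j. (w 1 / w 0 - w (j + 2) / w (j + 1)) / real (Suc j))"
    and "D = (\<lambda>j. d j / (real (Suc j) * w (j + 1)))"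
  have dpos: "d j > 0" for j unfolding d_def using pos by (intro sum_pos mult_pos_pos) auto
  have Dpos: "D j > 0" for j unfolding D_def using dpos pos by auto
  \<comment> \<open>Both sums run over the products \<open>w\<^sub>i w\<^sub>j\<^sub>+\<^sub>2\<^sub>-\<^sub>i\<close>, with \<open>i\<close> in \<open>{1..j + 1}\<close> and in \<open>{0..j}\<close>.\<close>
  have diff: "(\<Sum>i\<le>j. w i * w (j - i + 2)) = d j - w 0 * (s j * (real (Suc j) * w (j + 1)))" for j
  proof -
    have "d j - (\<Sum>i\<le>j. w i * w (j - i + 2))
        = (\<Sum>i<Suc j. w (Suc i) * w (j + 2 - Suc i) - w i * w (j + 2 - i))"
      unfolding d_def lessThan_Suc_atMost sum_subtractf[symmetric]
      by (intro sum.cong refl) (auto simp: Suc_diff_le)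
    also have "\<dots> = w (Suc j) * w 1 - w 0 * w (j + 2)"
      by (subst sum_lessThan_telescope) simp
    also have "\<dots> = w 0 * (s j * (real (Suc j) * w (j + 1)))"
    proof -
      have *: "s j * (real (Suc j) * w (j + 1)) = (w 1 / w 0 - w (j + 2) / w (j + 1)) * w (j + 1)"
        unfolding s_def by simp
      show ?thesis
        unfolding * using pos[of 0] pos[of "Suc j"] by (simp add: field_simps)
    qed
    finally show ?thesis by simp
  qed
  have quot: "(\<Sum>i\<le>j. w i * w (j - i + 2)) / d j = 1 - w 0 * (s j / D j)" for j
    using dpos[of j] pos[of "Suc j"] unfolding diff D_def by (simp add: diff_divide_distrib)
  have s_anti: "antimono s"
    using convex_seq_chord_antimono[of "\<lambda>k. w (Suc k) / w k"] convex
    by (simp add: s_def numeral_2_eq_2 numeral_3_eq_3)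
  have "antimono (\<lambda>k. w (Suc (Suc k)) / w (Suc k))"
    using dec by (auto simp: antimono_iff_le_Suc)
  then have D_mono: "mono D"
    using log_concave_convolution_mono[of "\<lambda>k. w (Suc k)"] pos by (simp add: D_def d_def Suc_diff_le)
  have s_nonneg: "s j \<ge> 0" for j
    using antimonoD[OF dec, of 0 "Suc j"] by (simp add: s_def)
  have "s (Suc j) / D (Suc j) \<le> s j / D j"
    using s_nonneg Dpos monoD[OF D_mono, of j "Suc j"] antimonoD[OF s_anti, of j "Suc j"]
    by (intro frac_le) auto
  then show "(\<Sum>i\<le>j. w i * w (j - i + 2)) / (\<Sum>i\<le>j. w (i + 1) * w (j - i + 1))
     \<le> (\<Sum>i\<le>Suc j. w i * w (Suc j - i + 2)) / (\<Sum>i\<le>Suc j. w (i + 1) * w (Suc j - i + 1))"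
    unfolding quot[unfolded d_def] using pos[of 0] by (intro diff_left_mono mult_left_mono) auto
qed

section \<open>The Turan quotient of consecutive sections of a power series\<close>

text \<open>
  Numerator and denominator are expanded as Cauchy products.  At \<open>0\<close> every section reduces to its
  first coefficient, which gives the limit.
\<close>
lemma turan_quotient:
  fixes w :: "nat \<Rightarrow> real"
  defines "F \<equiv> \<lambda>i z. \<Sum>k. w (k + i) * z ^ k"
  assumes pos: "\<And>k. w k > 0"
    and dec: "antimono (\<lambda>k. w (Suc k) / w k)"
    and convex: "\<And>k. 2 * (w (k + 2) / w (k + 1)) \<le> w (k + 1) / w k + w (k + 3) / w (k + 2)"
    and summ: "\<And>i z. summable (\<lambda>k. w (k + i) * z ^ k)"
  shows turan_quotient_mono_on: "mono_on {0<..} (\<lambda>z. F 0 z * F 2 z / (F 1 z)\<^sup>2)"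
    and turan_quotient_tendsto_at_0: "((\<lambda>z. F 0 z * F 2 z / (F 1 z)\<^sup>2) \<longlongrightarrow> w 0 * w 2 / (w 1)\<^sup>2) (at_right 0)"
    and shifted_series_pos: "z > 0 \<Longrightarrow> F i z > 0"
proof -
  define a b where "a = (\<lambda>j. \<Sum>i\<le>j. w i * w (j - i + 2))"
    and "b = (\<lambda>j. \<Sum>i\<le>j. w (i + 1) * w (j - i + 1))"
  have bpos: "b j > 0" for j unfolding b_def using pos by (intro sum_pos mult_pos_pos) auto
  have Fpos: "F i z > 0" if "z > 0" for i z
    unfolding F_def using that pos summ[of i z] by (intro suminf_pos) auto
  then show "z > 0 \<Longrightarrow> F i z > 0" .
  have prod: "(\<lambda>j. (\<Sum>l\<le>j. w (l + m) * w (j - l + m')) * z ^ j) sums (F m z * F m' z)" for m m' z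
  proof -
    have norm: "summable (\<lambda>k. norm (w (k + i) * z ^ k))" for i
      using summ[of i "\<bar>z\<bar>"] less_imp_le[OF pos] by (simp add: abs_mult power_abs)
    have "(\<Sum>l\<le>j. w (l + m) * z ^ l * (w (j - l + m') * z ^ (j - l)))
        = (\<Sum>l\<le>j. w (l + m) * w (j - l + m')) * z ^ j" for j
      unfolding sum_distrib_right
      by (intro sum.cong refl) (auto simp: mult_ac simp flip: power_add)
    then show ?thesis
      using Cauchy_product_sums[OF norm[of m] norm[of m']] by (simp add: F_def)
  qed
  have A: "(\<lambda>j. a j * z ^ j) sums (F 0 z * F 2 z)" for z using prod[of 0 2 z] by (simp add: a_def)
  have B: "(\<lambda>j. b j * z ^ j) sums (F 1 z)\<^sup>2" for z
    using prod[of 1 1 z] by (simp add: b_def power2_eq_square)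
  have mono: "mono (\<lambda>j. a j / b j)"
    unfolding a_def b_def by (rule convolution_quotient_mono[OF pos dec convex])
  show "mono_on {0<..} (\<lambda>z. F 0 z * F 2 z / (F 1 z)\<^sup>2)"
  proof (rule mono_onI)
    fix x y :: real assume "x \<in> {0<..}" "y \<in> {0<..}" "x \<le> y"
    moreover from this have "(F 0 x * F 2 x) * (F 1 y)\<^sup>2 \<le> (F 0 y * F 2 y) * (F 1 x)\<^sup>2"
      using powser_cross_mono[OF bpos mono, of x y] sums_summable[OF A] sums_summable[OF B]
      by (simp add: sums_unique[OF A, symmetric] sums_unique[OF B, symmetric])
    ultimately show "F 0 x * F 2 x / (F 1 x)\<^sup>2 \<le> F 0 y * F 2 y / (F 1 y)\<^sup>2"
      using Fpos by (intro divide_le_divide_cross zero_less_power) auto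
  qed
  have lim: "((\<lambda>z. F i z) \<longlongrightarrow> w i) (at_right 0)" for i
  proof -
    have "isCont (F i) 0"
      unfolding F_def by (rule isCont_powser[where K = 1]) (use summ[of i 1] in simp_all)
    moreover have "F i 0 = w i" unfolding F_def by simp
    ultimately show ?thesis
      using filterlim_at_split isCont_def by metis
  qed
  show "((\<lambda>z. F 0 z * F 2 z / (F 1 z)\<^sup>2) \<longlongrightarrow> w 0 * w 2 / (w 1)\<^sup>2) (at_right 0)"
    using pos[of 1] by (intro tendsto_intros lim) auto
qed

section \<open>Quotients of Gamma values\<close>

text \<open>Euler's limit formula for numerator and denominator; the factors \<open>N!\<close> cancel.\<close>
lemma Gamma_quotient_LIMSEQ:
  fixes b t :: real
  assumes "b > 0" "t \<ge> 0"
  shows "(\<lambda>N. exp (- t * ln (real N)) * (\<Prod>i\<le>N. 1 + t / (b + real i))) \<longlonglongrightarrow> Gamma b / Gamma (b + t)"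
proof (rule Lim_transform_eventually)
  show "(\<lambda>N. Gamma_series b N / Gamma_series (b + t) N) \<longlonglongrightarrow> Gamma b / Gamma (b + t)"
    using assms Gamma_real_pos[of "b + t"] less_imp_neq[OF Gamma_real_pos[of "b + t"]]
    by (intro tendsto_divide Gamma_series_LIMSEQ) auto
  have "Gamma_series b N / Gamma_series (b + t) N
      = exp (- t * ln (real N)) * (\<Prod>i\<le>N. 1 + t / (b + real i))" for N
  proof -
    have "(\<Prod>i\<le>N. 1 + t / (b + real i)) = (\<Prod>i\<le>N. (b + t + real i) / (b + real i))"
      using assms by (intro prod.cong refl) (simp add: field_simps add_pos_nonneg less_imp_neq)
    also have "\<dots> = pochhammer (b + t) (Suc N) / pochhammer b (Suc N)"
      by (simp add: pochhammer_prod prod_dividef lessThan_Suc_atMost atLeast0LessThan)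
    finally show ?thesis
      by (simp add: Gamma_series_def exp_minus exp_add distrib_right field_simps)
  qed
  then show "\<forall>\<^sub>F N in sequentially. Gamma_series b N / Gamma_series (b + t) N
      = exp (- t * ln (real N)) * (\<Prod>i\<le>N. 1 + t / (b + real i))" by simp
qed

lemma Gamma_quotient_antimono:
  fixes b c t :: real
  assumes "0 < b" "b \<le> c" "0 \<le> t"
  shows "Gamma c / Gamma (c + t) \<le> Gamma b / Gamma (b + t)"
proof (rule LIMSEQ_le[OF Gamma_quotient_LIMSEQ Gamma_quotient_LIMSEQ])
  show "\<exists>N0. \<forall>N\<ge>N0. exp (- t * ln (real N)) * (\<Prod>i\<le>N. 1 + t / (c + real i))
      \<le> exp (- t * ln (real N)) * (\<Prod>i\<le>N. 1 + t / (b + real i))"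
    using assms by (intro exI allI impI mult_left_mono prod_mono conjI add_left_mono divide_left_mono)
      auto
qed (use assms in auto)

text \<open>
  In Euler's product the exponential factor is the same at all three arguments, so the claim
  reduces to the single factors \<open>1 + t / x\<close>, where it is a polynomial inequality.
\<close>
lemma Gamma_quotient_log_convex:
  fixes b t :: real
  assumes "0 < b" "0 \<le> t"
  shows "(Gamma (b + t) / Gamma (b + 2 * t))\<^sup>2
       \<le> (Gamma b / Gamma (b + t)) * (Gamma (b + 2 * t) / Gamma (b + 3 * t))"
proof -
  define u where "u = (\<lambda>c N. exp (- t * ln (real N)) * (\<Prod>i\<le>N. 1 + t / (c + real i)))"
  have lim: "u c \<longlonglongrightarrow> Gamma c / Gamma (c + t)" if "c > 0" for c
    unfolding u_def using Gamma_quotient_LIMSEQ that assms by blast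
  have factor: "(1 + t / (x + t))\<^sup>2 \<le> (1 + t / x) * (1 + t / (x + 2 * t))" if x: "x > 0" for x
  proof -
    \<comment> \<open>The claim with cleared denominators; the right side exceeds the left by \<open>2 x t\<^sup>3 + 3 t\<^sup>4\<close>.\<close>
    have "(x + 2 * t) ^ 3 * x \<le> (x + t) ^ 3 * (x + 3 * t)"
    proof -
      have "(x + t) ^ 3 * (x + 3 * t) = (x + 2 * t) ^ 3 * x + (2 * x * t ^ 3 + 3 * t ^ 4)"
        by (simp add: eval_nat_numeral algebra_simps)
      then show ?thesis using x assms by simp
    qed
    then have "(x + 2 * t)\<^sup>2 * (x * (x + 2 * t)) \<le> ((x + t) * (x + 3 * t)) * (x + t)\<^sup>2"
      by (simp add: eval_nat_numeral mult_ac)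
    then have "((x + 2 * t) / (x + t))\<^sup>2 \<le> ((x + t) / x) * ((x + 3 * t) / (x + 2 * t))"
      using x assms unfolding power_divide times_divide_times_eq
      by (intro divide_le_divide_cross) (simp_all add: add_pos_nonneg)
    moreover have "1 + t / (x + t) = (x + 2 * t) / (x + t)" "1 + t / x = (x + t) / x"
      "1 + t / (x + 2 * t) = (x + 3 * t) / (x + 2 * t)" using x assms by (simp_all add: field_simps)
    ultimately show ?thesis by simp
  qed
  have "(u (b + t) N)\<^sup>2 \<le> u b N * u (b + 2 * t) N" for N
  proof -
    have "(\<Prod>i\<le>N. 1 + t / (b + t + real i))\<^sup>2
        \<le> (\<Prod>i\<le>N. 1 + t / (b + real i)) * (\<Prod>i\<le>N. 1 + t / (b + 2 * t + real i))"
      unfolding prod_power_distrib prod.distrib[symmetric]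
      using factor[of "b + real _"] assms by (intro prod_mono) (auto simp: add_ac)
    then have "(exp (- t * ln (real N)))\<^sup>2 * (\<Prod>i\<le>N. 1 + t / (b + t + real i))\<^sup>2
        \<le> (exp (- t * ln (real N)))\<^sup>2 *
           ((\<Prod>i\<le>N. 1 + t / (b + real i)) * (\<Prod>i\<le>N. 1 + t / (b + 2 * t + real i)))"
      by (intro mult_left_mono) auto
    then show ?thesis by (simp add: u_def power2_eq_square mult_ac)
  qed
  moreover have "(\<lambda>N. (u (b + t) N)\<^sup>2) \<longlonglongrightarrow> (Gamma (b + t) / Gamma (b + t + t))\<^sup>2"
    and "(\<lambda>N. u b N * u (b + 2 * t) N)
        \<longlonglongrightarrow> (Gamma b / Gamma (b + t)) * (Gamma (b + 2 * t) / Gamma (b + 2 * t + t))"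
    using assms by (intro tendsto_intros lim; simp)+
  ultimately have "(Gamma (b + t) / Gamma (b + t + t))\<^sup>2
       \<le> (Gamma b / Gamma (b + t)) * (Gamma (b + 2 * t) / Gamma (b + 2 * t + t))"
    using LIMSEQ_le by blast
  moreover have "b + t + t = b + 2 * t" "b + 2 * t + t = b + 3 * t" by simp_all
  ultimately show ?thesis by simp
qed

section \<open>The Fox-Wright coefficients and the theorem\<close>

text \<open>
  The ratio of consecutive coefficients is \<open>R\<^sub>k / (k + 1)\<close> with \<open>R\<^sub>k\<close> a product of Gamma quotients.
  Log-convexity, unlike convexity, passes to products, so it is established for both factors;
  convexity then follows from the inequality of arithmetic and geometric means.  Since \<open>R\<close> is
  bounded by \<open>R\<^sub>0\<close>, the ratios tend to \<open>0\<close> and the series converges everywhere.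
\<close>
lemma fox_wright_coefficients:
  fixes q :: nat and \<beta> B g :: "nat \<Rightarrow> real"
  assumes \<beta>: "\<And>j. j \<in> {1..q} \<Longrightarrow> \<beta> j > 0" and B: "\<And>j. j \<in> {1..q} \<Longrightarrow> B j \<ge> 0"
    and g_def: "\<And>k. g k = 1 / (fact k * (\<Prod>j=1..q. Gamma (\<beta> j + real k * B j)))"
  shows g_pos: "g k > 0"
    and g_ratio_antimono: "antimono (\<lambda>k. g (Suc k) / g k)"
    and g_ratio_convex: "2 * (g (k + 2) / g (k + 1)) \<le> g (k + 1) / g k + g (k + 3) / g (k + 2)"
    and g_summable: "summable (\<lambda>k. g (k + i) * z ^ k)"
proof -
  define R where "R = (\<lambda>k. \<Prod>j=1..q. Gamma (\<beta> j + real k * B j) / Gamma (\<beta> j + real k * B j + B j))"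
  have arg: "\<beta> j + real k * B j > 0" if "j \<in> {1..q}" for j k
    using \<beta>[OF that] B[OF that] by (simp add: add_pos_nonneg)
  have R_factor_pos: "Gamma (\<beta> j + real k * B j) / Gamma (\<beta> j + real k * B j + B j) > 0"
    if "j \<in> {1..q}" for j k
    using arg[OF that, of k] B[OF that] by (intro divide_pos_pos Gamma_real_pos) auto
  have gpos: "g k > 0" for k
    unfolding g_def using arg by (intro divide_pos_pos mult_pos_pos prod_pos Gamma_real_pos) auto
  then show "g k > 0" .
  have Rpos: "R k > 0" for k
    unfolding R_def using R_factor_pos by (intro prod_pos) auto
  have ratio: "g (Suc k) / g k = R k / real (Suc k)" for k
  proof -
    have "(\<Prod>j=1..q. Gamma (\<beta> j + real (Suc k) * B j)) = (\<Prod>j=1..q. Gamma (\<beta> j + real k * B j + B j))"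
      by (simp add: algebra_simps)
    then show ?thesis
      by (simp add: g_def R_def prod_dividef)
  qed
  have R_dec: "R (Suc k) \<le> R k" for k
    unfolding R_def
  proof (rule prod_mono, intro conjI)
    fix j assume j: "j \<in> {1..q}"
    show "0 \<le> Gamma (\<beta> j + real (Suc k) * B j) / Gamma (\<beta> j + real (Suc k) * B j + B j)"
      using R_factor_pos[OF j] less_imp_le by blast
    show "Gamma (\<beta> j + real (Suc k) * B j) / Gamma (\<beta> j + real (Suc k) * B j + B j)
        \<le> Gamma (\<beta> j + real k * B j) / Gamma (\<beta> j + real k * B j + B j)"
      using arg[OF j, of k] B[OF j] by (intro Gamma_quotient_antimono) (auto simp: algebra_simps)
  qed
  have R_log_convex: "(R (Suc k))\<^sup>2 \<le> R k * R (Suc (Suc k))" for k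
    unfolding R_def prod_power_distrib prod.distrib[symmetric]
  proof (rule prod_mono, intro conjI)
    fix j assume j: "j \<in> {1..q}"
    show "(Gamma (\<beta> j + real (Suc k) * B j) / Gamma (\<beta> j + real (Suc k) * B j + B j))\<^sup>2
        \<le> Gamma (\<beta> j + real k * B j) / Gamma (\<beta> j + real k * B j + B j) *
          (Gamma (\<beta> j + real (Suc (Suc k)) * B j) / Gamma (\<beta> j + real (Suc (Suc k)) * B j + B j))"
      using Gamma_quotient_log_convex[OF arg[OF j, of k] B[OF j]] by (simp add: algebra_simps)
  qed simp
  show "antimono (\<lambda>k. g (Suc k) / g k)"
    unfolding ratio using R_dec less_imp_le[OF Rpos]
    by (auto simp: antimono_iff_le_Suc intro!: frac_le)
  have "2 * (R (Suc k) / real (Suc (Suc k)))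
      \<le> R k / real (Suc k) + R (Suc (Suc k)) / real (Suc (Suc (Suc k)))"
  proof (rule log_convex_imp_convex_step)
    have "(R (Suc k) / real (Suc (Suc k)))\<^sup>2 \<le> (R k * R (Suc (Suc k))) / (real (Suc (Suc k)))\<^sup>2"
      unfolding power_divide by (intro divide_right_mono R_log_convex) auto
    also have "\<dots> \<le> (R k * R (Suc (Suc k))) / (real (Suc k) * real (Suc (Suc (Suc k))))"
      using less_imp_le[OF Rpos] 
      by (intro divide_left_mono) (auto simp: power2_eq_square algebra_simps intro!: mult_nonneg_nonneg add_pos_nonneg)
    finally show "(R (Suc k) / real (Suc (Suc k)))\<^sup>2
        \<le> R k / real (Suc k) * (R (Suc (Suc k)) / real (Suc (Suc (Suc k))))" by simp
  qed (use less_imp_le[OF Rpos] in auto)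
  then show "2 * (g (k + 2) / g (k + 1)) \<le> g (k + 1) / g k + g (k + 3) / g (k + 2)"
    using ratio[of k] ratio[of "Suc k"] ratio[of "Suc (Suc k)"]
    by (simp add: numeral_2_eq_2 numeral_3_eq_3)
  show "summable (\<lambda>k. g (k + i) * z ^ k)"
  proof (rule summable_ratio_test)
    \<comment> \<open>From this index on, \<open>R\<^sub>0 \<bar>z\<bar> / (k + 1) \<le> 1/2\<close>.\<close>
    define M where "M = nat \<lceil>2 * R 0 * \<bar>z\<bar>\<rceil>"
    have R0: "R k \<le> R 0" for k
      using R_dec by (rule lift_Suc_antimono_le) simp
    show "norm (g (Suc k + i) * z ^ Suc k) \<le> 1 / 2 * norm (g (k + i) * z ^ k)" if "M \<le> k" for k
    proof -
      have "2 * R 0 * \<bar>z\<bar> \<le> real (Suc (k + i))"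
        using that unfolding M_def by linarith
      then have "2 * (R (k + i) * \<bar>z\<bar>) \<le> real (Suc (k + i))"
        using mult_right_mono[OF R0[of "k + i"], of "\<bar>z\<bar>"] by simp
      then have step: "R (k + i) / real (Suc (k + i)) * \<bar>z\<bar> \<le> 1 / 2"
        by (simp add: field_simps)
      have "norm (g (Suc k + i) * z ^ Suc k) = (g (Suc (k + i)) / g (k + i) * \<bar>z\<bar>) * (g (k + i) * \<bar>z\<bar> ^ k)"
        using gpos[of "k + i"] gpos[of "Suc (k + i)"] by (simp add: abs_mult power_abs)
      also have "\<dots> \<le> 1 / 2 * (g (k + i) * \<bar>z\<bar> ^ k)"
        unfolding ratio using step less_imp_le[OF gpos] by (intro mult_right_mono) auto
      also have "\<dots> = 1 / 2 * norm (g (k + i) * z ^ k)"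
        using gpos[of "k + i"] by (simp add: abs_mult power_abs)
      finally show ?thesis .
    qed
  qed simp
qed

theorem theorem5:
  fixes p q n :: nat and \<alpha> \<beta> B :: "nat \<Rightarrow> real"
  assumes "\<And>j. j \<in> {1..p} \<Longrightarrow> \<alpha> j > 0"
    and "\<And>j. j \<in> {1..q} \<Longrightarrow> \<beta> j > 0"
    and "\<And>j. j \<in> {1..q} \<Longrightarrow> B j \<ge> 0"
    and "n \<ge> 1"
  shows "mono_on {0<..} (\<lambda>z. K_ratio p q \<alpha> \<beta> B n z) \<and>
    (let c = (real n + 2) / (real n + 3) *
           ((\<Prod>j=1..q. (Gamma (\<beta> j + (real n + 2) * B j))\<^sup>2) /
            (\<Prod>j=1..q. Gamma (\<beta> j + (real n + 1) * B j) * Gamma (\<beta> j + (real n + 3) * B j)))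
     in (\<forall>z>0. c * (Psi_sec p q \<alpha> \<beta> B (n + 1) z)\<^sup>2
               \<le> Psi_sec p q \<alpha> \<beta> B n z * Psi_sec p q \<alpha> \<beta> B (n + 2) z) \<and>
        (\<forall>C>c. \<not> (\<forall>z>0. C * (Psi_sec p q \<alpha> \<beta> B (n + 1) z)\<^sup>2
               \<le> Psi_sec p q \<alpha> \<beta> B n z * Psi_sec p q \<alpha> \<beta> B (n + 2) z)))"
proof -
  define g :: "nat \<Rightarrow> real" where "g k = 1 / (fact k * (\<Prod>j=1..q. Gamma (\<beta> j + real k * B j)))" for k
  \<comment> \<open>The index shift absorbs the removed terms \<open>0, \<dots>, n\<close>.\<close>
  define w where "w k = g (k + (n + 1))" for k
  define F where "F i z = (\<Sum>k. w (k + i) * z ^ k)" for i z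
  define P where "P = (\<Prod>j=1..p. Gamma (\<alpha> j))"
  define c where "c = (real n + 2) / (real n + 3) *
           ((\<Prod>j=1..q. (Gamma (\<beta> j + (real n + 2) * B j))\<^sup>2) /
            (\<Prod>j=1..q. Gamma (\<beta> j + (real n + 1) * B j) * Gamma (\<beta> j + (real n + 3) * B j)))"
  let ?\<Psi> = "Psi_sec p q \<alpha> \<beta> B" and ?K = "\<lambda>z. K_ratio p q \<alpha> \<beta> B n z"
  note g = fox_wright_coefficients[OF assms(2,3) g_def]
  have Ppos: "P > 0" unfolding P_def using assms(1) by (intro prod_pos Gamma_real_pos) auto
  have wpos: "w k > 0" for k unfolding w_def by (rule g(1))
  have w_dec: "antimono (\<lambda>k. w (Suc k) / w k)"
    using g(2) by (simp add: w_def antimono_iff_le_Suc)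
  have w_convex: "2 * (w (k + 2) / w (k + 1)) \<le> w (k + 1) / w k + w (k + 3) / w (k + 2)" for k
    using g(3)[of "k + (n + 1)"] by (simp add: w_def add_ac)
  have w_summ: "summable (\<lambda>k. w (k + i) * z ^ k)" for i z
    using g(4)[of "i + (n + 1)" z] by (simp add: w_def add_ac)
  note turan = turan_quotient[OF wpos w_dec w_convex w_summ, folded F_def]
  have Psi: "?\<Psi> (n + i) z = P * z ^ (n + i + 1) * F i z" for i z
  proof -
    have "?\<Psi> (n + i) z = (\<Sum>k. (P * z ^ (n + i + 1)) * (w (k + i) * z ^ k))"
      unfolding Psi_sec_eq P_def[symmetric] w_def g_def
      by (intro suminf_cong) (simp add: power_add add_ac mult_ac)
    also have "\<dots> = P * z ^ (n + i + 1) * F i z"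
      unfolding F_def by (rule suminf_mult[OF w_summ])
    finally show ?thesis .
  qed
  have Psi_pos: "?\<Psi> (n + 1) z > 0" if "z > 0" for z
    unfolding Psi using Ppos that turan(3)[OF that] by simp
  have K_eq: "?K z = F 0 z * F 2 z / (F 1 z)\<^sup>2" if "z > 0" for z
  proof -
    have "?\<Psi> n z * ?\<Psi> (n + 2) z = (P * z ^ (n + 2))\<^sup>2 * (F 0 z * F 2 z)"
      using Psi[of 0 z] Psi[of 2 z] by (simp add: power2_eq_square mult_ac)
    moreover have "(?\<Psi> (n + 1) z)\<^sup>2 = (P * z ^ (n + 2))\<^sup>2 * (F 1 z)\<^sup>2"
      using Psi[of 1 z] by (simp add: power_mult_distrib)
    moreover have "(P * z ^ (n + 2))\<^sup>2 \<noteq> 0" using Ppos that by simp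
    ultimately show ?thesis unfolding K_ratio_def by simp
  qed
  have K_mono: "mono_on {0<..} ?K"
    using turan(1) by (auto simp: mono_on_def K_eq)
  have c_eq: "c = w 0 * w 2 / (w 1)\<^sup>2"
  proof -
    define G where "G k = (\<Prod>j=1..q. Gamma (\<beta> j + real k * B j))" for k :: nat
    define f :: real where "f = fact (n + 1)"
    have G: "G k > 0" for k
      unfolding G_def using assms(2,3) by (intro prod_pos Gamma_real_pos ballI) (auto intro!: add_pos_nonneg)
    have f: "f > 0" unfolding f_def by simp
    have fact: "fact (n + 2) = (real n + 2) * f" "fact (n + 3) = (real n + 3) * ((real n + 2) * f)"
      by (simp_all add: f_def numeral_2_eq_2 numeral_3_eq_3 algebra_simps)
    have w: "w 0 = 1 / (f * G (n + 1))" "w 1 = 1 / ((real n + 2) * f * G (n + 2))"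
      "w 2 = 1 / ((real n + 3) * ((real n + 2) * f) * G (n + 3))"
      unfolding fact[symmetric] by (simp_all add: w_def g_def G_def f_def add_ac numeral_2_eq_2 numeral_3_eq_3)
    have c: "c = (real n + 2) / (real n + 3) * ((G (n + 2))\<^sup>2 / (G (n + 1) * G (n + 3)))"
      unfolding c_def G_def prod.distrib prod_power_distrib[symmetric] by (simp add: add_ac)
    have "a / b * (y\<^sup>2 / (x * v)) = 1 / (f * x) * (1 / (b * (a * f) * v)) / (1 / (a * f * y))\<^sup>2"
      if "a > 0" "b > 0" "x > 0" "y > 0" "v > 0" for a b x y v :: real
      using that f by (simp add: field_simps power2_eq_square)
    then show ?thesis
      unfolding w c using G by simp
  qed
  have K_lim: "(?K \<longlongrightarrow> c) (at_right 0)"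
    unfolding c_eq using turan(2)
    by (rule Lim_transform_eventually) 
      (auto simp: K_eq intro: eventually_mono[OF eventually_at_right_less])
  have iff: "C * (?\<Psi> (n + 1) z)\<^sup>2 \<le> ?\<Psi> n z * ?\<Psi> (n + 2) z \<longleftrightarrow> C \<le> ?K z" if "z > 0" for C z
    unfolding K_ratio_def using Psi_pos[OF that] by (simp add: pos_le_divide_eq)
  have lower: "c \<le> ?K z" if "z > 0" for z
  proof (rule tendsto_upperbound[OF K_lim])
    show "\<forall>\<^sub>F x in at_right 0. ?K x \<le> ?K z"
      unfolding eventually_at_right_field using that mono_onD[OF K_mono]
      by (intro exI[of _ z]) auto
  qed simp
  have sharp: "C \<le> c" if "\<And>z. z > 0 \<Longrightarrow> C \<le> ?K z" for C
  proof (rule tendsto_lowerbound[OF K_lim])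
    show "\<forall>\<^sub>F x in at_right 0. C \<le> ?K x"
      using that by (auto intro: eventually_mono[OF eventually_at_right_less])
  qed simp
  have "\<forall>z>0. c * (?\<Psi> (n + 1) z)\<^sup>2 \<le> ?\<Psi> n z * ?\<Psi> (n + 2) z"
    using lower iff by blast
  moreover have "\<forall>C>c. \<not> (\<forall>z>0. C * (?\<Psi> (n + 1) z)\<^sup>2 \<le> ?\<Psi> n z * ?\<Psi> (n + 2) z)"
    using sharp iff by (meson not_le)
  ultimately show ?thesis
    unfolding c_def[symmetric] Let_def using K_mono by blast
qed

end
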